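(* Let $\frac{a}{b} < \frac{c}{d}$ be non-negative fractions in lowest terms (with $b,d>0$) whose cross-determinant is of the form $bc - ad = 2^m 3^n$ with integers $m,n \ge 0$. Then every rational number in the interval $\left[\frac{a}{b}, \frac{c}{d}\right]$ appears in some row $S_i\left(\frac{a}{b},\frac{c}{d}\right)$. Furthermore, after finitely many rows, each pair of consecutive elements in all subsequent rows has cross-determinant $1$; that is, there exists $L$ such that for all $i\ge L$ every two consecutive elements of $S_i\left(\frac{a}{b},\frac{c}{d}\right)$ have cross-determinant $1$.
   Context: All fractions are written in lowest terms with positive denominator. The cross-determinant of two consecutive reduced fractions $\frac{p}{q}, \frac{r}{s}$ (in this order) is $qr - ps$. The mediant of two reduced fractions $\frac{p}{q}$ and $\frac{r}{s}$ is the fraction $\frac{p+r}{q+s}$ put in lowest terms. Given two non-negative rational numbers $\frac{a}{b} < \frac{c}{d}$ in lowest terms, define finite sequences (rows) $S_i\left(\frac{a}{b},\frac{c}{d}\right)$, $i \ge 0$, of reduced fractions: $S_0 = \left(\frac{a}{b}, \frac{c}{d}\right)$, and $S_{i+1}$ is obtained from $S_i$ by copying all terms and inserting between every two consecutive terms their (reduced) mediant, where the mediant is computed from the reduced forms of the two terms. *)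

theory Defs
  imports Complex_Main
begin

text \<open>
  Reduced fractions are elements of type \<^typ>\<open>rat\<close>; \<^const>\<open>quotient_of\<close> yields the unique
  representation in lowest terms with positive denominator, and \<^const>\<open>Fract\<close> reduces
  automatically. Both operations below hence act on reduced forms.
\<close>

definition mediant :: "rat \<Rightarrow> rat \<Rightarrow> rat" where
  "mediant x y = (case (quotient_of x, quotient_of y) of
     ((p, q), (r, s)) \<Rightarrow> Fract (p + r) (q + s))"

definition cross_det :: "rat \<Rightarrow> rat \<Rightarrow> int" where
  "cross_det x y = (case (quotient_of x, quotient_of y) of
     ((p, q), (r, s)) \<Rightarrow> q * r - p * s)"

fun insert_mediants :: "rat list \<Rightarrow> rat list" where
  "insert_mediants [] = []"
| "insert_mediants [x] = [x]"
| "insert_mediants (x # y # zs) = x # mediant x y # insert_mediants (y # zs)"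

primrec mediant_row :: "rat \<Rightarrow> rat \<Rightarrow> nat \<Rightarrow> rat list" where
  "mediant_row x y 0 = [x, y]"
| "mediant_row x y (Suc i) = insert_mediants (mediant_row x y i)"

end

theory Submission
  imports Defs "HOL-Computational_Algebra.Primes"
begin

text \<open>
  Let \<open>g\<close> be the factor cancelled when the mediant of two fractions with cross-determinant \<open>D\<close>
  is reduced; both new cross-determinants equal \<open>D / g\<close>. If a prime \<open>l\<close> divides \<open>D\<close>, the
  vectors (numerator, denominator) are proportional modulo \<open>l\<close>. For \<open>l = 2\<close> they are equal, so
  \<open>g\<close> is even. For \<open>l = 3\<close> they are either opposite, so that \<open>3\<close> divides \<open>g\<close>, or equal; in the
  latter case and for odd \<open>D\<close> nothing cancels, but the mediant is then opposite to both of its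
  neighbours, so a factor \<open>3\<close> cancels one row later. Hence all cross-determinants drop to \<open>1\<close>,
  where the classical Stern--Brocot argument applies.
\<close>

section \<open>Rows\<close>

text \<open>A row can be cut at \<open>w\<close>, because mediants arise only between neighbours.
  The three equations share their witnesses, so both halves and the whole row can be followed
  together through further insertions.\<close>

lemma insert_mediants_split:
  "\<exists>us' vs'. insert_mediants (us @ [w]) = us' @ [w] \<and> insert_mediants (w # vs) = w # vs' \<and>
     insert_mediants (us @ w # vs) = us' @ w # vs'"
proof (induction us rule: induct_list012)
  case 1
  then show ?case by (cases vs) auto
next
  case (2 u)
  then show ?case by (cases vs) auto
next
  case (3 u u' us)
  then obtain us' vs' where
    "insert_mediants ((u' # us) @ [w]) = us' @ [w]" "insert_mediants (w # vs) = w # vs'"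
    "insert_mediants ((u' # us) @ w # vs) = us' @ w # vs'" by blast
  then show ?case by (intro exI[of _ "u # mediant u u' # us'"] exI[of _ vs']) auto
qed

text \<open>Turns the recursion on rows into one on intervals: the next row is that of the two
  halves, glued at the mediant.\<close>

lemma mediant_row_Suc_split:
  "\<exists>us vs. mediant_row x (mediant x y) i = us @ [mediant x y] \<and>
     mediant_row (mediant x y) y i = mediant x y # vs \<and>
     mediant_row x y (Suc i) = us @ mediant x y # vs"
proof (induction i)
  case 0
  then show ?case by (intro exI[of _ "[x]"] exI[of _ "[y]"]) auto
next
  case (Suc i)
  then obtain us vs where "mediant_row x (mediant x y) i = us @ [mediant x y]"
    "mediant_row (mediant x y) y i = mediant x y # vs"
    "mediant_row x y (Suc i) = us @ mediant x y # vs" by blast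
  with insert_mediants_split[of us "mediant x y" vs] show ?case by simp
qed

lemma set_mediant_row_Suc:
  "set (mediant_row x y (Suc i)) =
     set (mediant_row x (mediant x y) i) \<union> set (mediant_row (mediant x y) y i)"
  using mediant_row_Suc_split[of x y i] by auto

abbreviation unimodular :: "rat list \<Rightarrow> bool" where
  "unimodular \<equiv> successively (\<lambda>x y. cross_det x y = 1)"

lemma unimodular_mediant_row_Suc:
  assumes "unimodular (mediant_row x (mediant x y) i)"
    and "unimodular (mediant_row (mediant x y) y i)"
  shows "unimodular (mediant_row x y (Suc i))"
proof -
  obtain us vs where "mediant_row x (mediant x y) i = us @ [mediant x y]"
    "mediant_row (mediant x y) y i = mediant x y # vs"
    and row: "mediant_row x y (Suc i) = us @ mediant x y # vs"
    using mediant_row_Suc_split by blast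
  with assms have "unimodular (us @ [mediant x y])" "unimodular (mediant x y # vs)" by simp_all
  then show ?thesis unfolding row successively_append_iff by auto
qed

text \<open>Both conclusions of the theorem for one pair, bundled because both pass from the two
  halves of an interval to the whole.\<close>

definition resolved :: "rat \<Rightarrow> rat \<Rightarrow> bool" where
  "resolved x y \<longleftrightarrow> (\<forall>z. x \<le> z \<and> z \<le> y \<longrightarrow> (\<exists>i. z \<in> set (mediant_row x y i))) \<and>
     (\<exists>L. \<forall>i\<ge>L. unimodular (mediant_row x y i))"

lemma resolved_via_mediant:
  assumes "resolved x (mediant x y)" "resolved (mediant x y) y"
  shows "resolved x y"
proof -
  let ?w = "mediant x y"
  have "\<exists>i. z \<in> set (mediant_row x y i)" if "x \<le> z" "z \<le> y" for z
  proof -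
    have "\<exists>i. z \<in> set (mediant_row x ?w i) \<union> set (mediant_row ?w y i)"
      using assms that linear[of z ?w] unfolding resolved_def by blast
    then show ?thesis using set_mediant_row_Suc by blast
  qed
  moreover obtain K L where "\<forall>i\<ge>K. unimodular (mediant_row x ?w i)"
    and "\<forall>i\<ge>L. unimodular (mediant_row ?w y i)"
    using assms unfolding resolved_def by blast
  \<comment> \<open>Row \<open>i\<close> of the pair consists of rows \<open>i - 1\<close> of its
    halves, hence the successor.\<close>
  then have "unimodular (mediant_row x y i)" if "i \<ge> Suc (max K L)" for i
    using that unimodular_mediant_row_Suc[of x y "i - 1"] by (cases i) auto
  ultimately show ?thesis unfolding resolved_def by blast
qed

section \<open>Cross-determinants\<close>

lemma less_iff_cross_det: "x < y \<longleftrightarrow> 0 < cross_det x y"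
proof -
  obtain p q r s where qx: "quotient_of x = (p, q)" and qy: "quotient_of y = (r, s)"
    by (metis surj_pair)
  have "q > 0" "s > 0" using qx qy quotient_of_denom_pos by auto
  moreover have "x = Fract p q" "y = Fract r s"
    using qx qy by (simp_all add: quotient_of_div Fract_of_int_quotient)
  ultimately show ?thesis
    using qx qy by (simp add: cross_det_def mult.commute)
qed

text \<open>By bilinearity, adding one vector to the other keeps the determinant; reducing the sum
  then divides it by the cancelled factor \<open>g\<close>.\<close>

lemma mediant_quotient:
  assumes "quotient_of x = (p, q)" "quotient_of y = (r, s)"
  obtains g p' q' where "g > 0" "p + r = g * p'" "q + s = g * q'"
    "quotient_of (mediant x y) = (p', q')" "coprime p' q'"
    "cross_det x y = g * cross_det x (mediant x y)"
    "cross_det x y = g * cross_det (mediant x y) y"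
proof -
  define g where "g = gcd (p + r) (q + s)"
  define p' q' where "p' = (p + r) div g" and "q' = (q + s) div g"
  have pos: "q + s > 0" using assms quotient_of_denom_pos by (simp add: add_pos_pos)
  then have g: "g > 0" by (simp add: g_def)
  have 1: "p + r = g * p'" "q + s = g * q'" by (simp_all add: g_def p'_def q'_def)
  have "quotient_of (mediant x y) = Rat.normalize (p + r, q + s)"
    by (simp add: mediant_def assms quotient_of_Fract)
  also have "\<dots> = (p', q')"
    using pos by (simp add: Rat.normalize_def p'_def q'_def g_def Let_def)
  finally have 2: "quotient_of (mediant x y) = (p', q')" .
  have "g * (q * p' - p * q') = q * (g * p') - p * (g * q')" by (simp add: algebra_simps)
  also have "\<dots> = q * r - p * s" by (simp add: 1[symmetric] algebra_simps)
  finally have 3: "g * (q * p' - p * q') = q * r - p * s" .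
  have "g * (q' * r - p' * s) = (g * q') * r - (g * p') * s" by (simp add: algebra_simps)
  also have "\<dots> = q * r - p * s" by (simp add: 1[symmetric] algebra_simps)
  finally have 4: "g * (q' * r - p' * s) = q * r - p * s" .
  show ?thesis
    using that[OF g 1 2] quotient_of_coprime[OF 2] 3 4 by (simp add: cross_det_def assms 2)
qed

lemma mediant_cross_det_1:
  assumes "cross_det x y = 1"
  shows "cross_det x (mediant x y) = 1" "cross_det (mediant x y) y = 1"
    and "snd (quotient_of (mediant x y)) = snd (quotient_of x) + snd (quotient_of y)"
proof -
  obtain p q r s where q: "quotient_of x = (p, q)" "quotient_of y = (r, s)"
    by (metis surj_pair)
  then obtain g p' q' where g: "g > 0" "q + s = g * q'" "quotient_of (mediant x y) = (p', q')"
    "1 = g * cross_det x (mediant x y)" "1 = g * cross_det (mediant x y) y"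
    using mediant_quotient assms by metis
  then have "g = 1" by (metis pos_zmult_eq_1_iff)
  with g q show "cross_det x (mediant x y) = 1" "cross_det (mediant x y) y = 1"
    "snd (quotient_of (mediant x y)) = snd (quotient_of x) + snd (quotient_of y)"
    by simp_all
qed

text \<open>The denominator of \<open>z\<close> is a combination of two determinants, both positive
  integers, with the denominators of \<open>y\<close> and \<open>x\<close> as weights.\<close>

lemma denominator_bound:
  assumes "cross_det x y = 1" "x < z" "z < y"
  shows "snd (quotient_of x) + snd (quotient_of y) \<le> snd (quotient_of z)"
proof -
  obtain p q r s u v where q: "quotient_of x = (p, q)" "quotient_of y = (r, s)"
    "quotient_of z = (u, v)" by (metis surj_pair)
  have pos: "q > 0" "s > 0" using q quotient_of_denom_pos by auto
  have "cross_det x z \<ge> 1" "cross_det z y \<ge> 1"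
    using assms(2,3) by (simp_all add: less_iff_cross_det)
  then have "1 \<le> q * u - p * v" "1 \<le> v * r - u * s" by (simp_all add: cross_det_def q)
  then have "s * 1 + q * 1 \<le> s * (q * u - p * v) + q * (v * r - u * s)"
    using pos by (intro add_mono mult_left_mono) auto
  also have "\<dots> = v * (q * r - p * s)" by (simp add: algebra_simps)
  also have "\<dots> = v" using assms(1) by (simp add: cross_det_def q)
  finally show ?thesis by (simp add: q)
qed

lemma cross_det_1_covers:
  assumes "cross_det x y = 1" "x \<le> z" "z \<le> y"
  shows "\<exists>i. z \<in> set (mediant_row x y i)"
  using assms
\<comment> \<open>Passing to a half raises the sum of the end denominators. The summand 1 keeps the
  measure positive for \<open>z\<close> strictly inside, even when the bound is attained, so
  truncation by \<open>nat\<close> does not hide the decrease.\<close>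
proof (induction "nat (1 + snd (quotient_of z) - snd (quotient_of x) - snd (quotient_of y))"
    arbitrary: x y rule: less_induct)
  case less
  let ?w = "mediant x y"
  show ?case
  proof (cases "z = x \<or> z = y")
    case True
    then show ?thesis by (intro exI[of _ 0]) auto
  next
    case False
    then have "snd (quotient_of x) + snd (quotient_of y) \<le> snd (quotient_of z)"
      using less.prems by (intro denominator_bound) auto
    moreover have "snd (quotient_of x) > 0" "snd (quotient_of y) > 0"
      by (simp_all add: quotient_of_denom_pos')
    moreover note w = mediant_cross_det_1[OF less.prems(1)]
    ultimately have "z \<le> ?w \<Longrightarrow> \<exists>i. z \<in> set (mediant_row x ?w i)"
      "?w \<le> z \<Longrightarrow> \<exists>i. z \<in> set (mediant_row ?w y i)"
      using less.prems(2,3) by (auto intro!: less.hyps)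
    then have "\<exists>i. z \<in> set (mediant_row x ?w i) \<union> set (mediant_row ?w y i)"
      using linear[of z ?w] by blast
    then show ?thesis using set_mediant_row_Suc by blast
  qed
qed

lemma cross_det_1_unimodular:
  "cross_det x y = 1 \<Longrightarrow> unimodular (mediant_row x y i)"
proof (induction i arbitrary: x y)
  case 0
  then show ?case by simp
next
  case (Suc i)
  then show ?case using unimodular_mediant_row_Suc mediant_cross_det_1 by blast
qed

lemma cross_det_1_resolved: "cross_det x y = 1 \<Longrightarrow> resolved x y"
  by (simp add: resolved_def cross_det_1_covers cross_det_1_unimodular)

section \<open>Cancellation of 2 and 3\<close>

lemma even_cross_imp_even_sum:
  fixes p q r s :: int
  assumes "coprime p q" "coprime r s" "even (q * r - p * s)"
  shows "even (p + r) \<and> even (q + s)"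
proof -
  have "\<not> (even p \<and> even q)" "\<not> (even r \<and> even s)"
    using assms(1,2) not_coprimeI[of 2] by fastforce+
  then show ?thesis using assms(3) by auto
qed

text \<open>Modulo 3 both vectors are nonzero and proportional, and the only nonzero scalars are 1
  and -1. The proof checks all residues.\<close>

lemma three_dvd_cross_imp_three_dvd_sum_or_diff:
  fixes p q r s :: int
  assumes "coprime p q" "coprime r s" "3 dvd q * r - p * s"
  shows "3 dvd p + r \<and> 3 dvd q + s \<or> 3 dvd p - r \<and> 3 dvd q - s"
proof -
  define P Q R S where "P = p mod 3" and "Q = q mod 3" and "R = r mod 3" and "S = s mod 3"
  note PQRS = P_def Q_def R_def S_def
  have residues: "P \<in> {0, 1, 2}" "Q \<in> {0, 1, 2}" "R \<in> {0, 1, 2}" "S \<in> {0, 1, 2}"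
    unfolding PQRS insert_iff empty_iff by presburger+
  have "\<not> (3 dvd p \<and> 3 dvd q)" "\<not> (3 dvd r \<and> 3 dvd s)"
    using assms(1,2) not_coprimeI[of 3] by fastforce+
  then have nz: "\<not> (P = 0 \<and> Q = 0)" "\<not> (R = 0 \<and> S = 0)"
    by (simp_all add: PQRS dvd_eq_mod_eq_0)
  have "(Q * R - P * S) mod 3 = 0"
    using assms(3) mod_diff_eq[of "q * r" 3 "p * s"] mod_mult_eq[of q 3 r] mod_mult_eq[of p 3 s]
    unfolding PQRS by (metis dvd_eq_mod_eq_0 mod_diff_eq)
  then have "(P + R) mod 3 = 0 \<and> (Q + S) mod 3 = 0 \<or> P = R \<and> Q = S"
    using residues nz by (elim insertE; simp)
  then show ?thesis
    by (simp add: PQRS mod_add_eq dvd_eq_mod_eq_0 mod_eq_dvd_iff)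
qed

text \<open>Applied with \<open>g\<close> the cancelled factor: a prime dividing both coordinates of
  an unreduced mediant is cancelled.\<close>

lemma prime_dvd_multiples_of_coprime:
  fixes l g p q :: int
  assumes "prime l" "coprime p q" "l dvd g * p" "l dvd g * q"
  shows "l dvd g"
proof (rule ccontr)
  assume "\<not> l dvd g"
  then have "l dvd p" "l dvd q" using assms by (simp_all add: prime_dvd_mult_iff)
  then have "is_unit l" using assms(2) coprime_common_divisor by blast
  then show False using assms(1) not_prime_unit by blast
qed

text \<open>A condition on prime divisors, instead of the explicit form
  \<open>2 ^ m * 3 ^ n\<close>, passes to divisors at once.\<close>

definition smooth3 :: "int \<Rightarrow> bool" where
  "smooth3 D \<longleftrightarrow> D > 0 \<and> (\<forall>l. prime l \<and> l dvd D \<longrightarrow> l = 2 \<or> l = 3)"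

lemma smooth3_factor: "smooth3 (g * D) \<Longrightarrow> g > 0 \<Longrightarrow> smooth3 D"
  unfolding smooth3_def by (metis dvd_mult zero_less_mult_pos)

lemma smooth3_2_3: "smooth3 (2 ^ m * 3 ^ n)"
proof -
  have "l = 2 \<or> l = 3" if "prime l" "l dvd 2 ^ m * 3 ^ n" for l :: int
  proof -
    have "l dvd 2 \<or> l dvd 3" using that prime_dvd_mult_iff prime_dvd_power by blast
    moreover have "prime (2::int)" "prime (3::int)" by simp_all
    ultimately show ?thesis using that(1) primes_dvd_imp_eq by blast
  qed
  then show ?thesis by (simp add: smooth3_def)
qed

text \<open>Strong induction on the determinant: at most two subdivisions make it drop on every
  subinterval.\<close>

lemma smooth3_resolved: "smooth3 (cross_det x y) \<Longrightarrow> resolved x y"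
proof (induction "nat (cross_det x y)" arbitrary: x y rule: less_induct)
  case less
  let ?D = "cross_det x y" and ?w = "mediant x y"
  have D0: "?D > 0" using less.prems by (simp add: smooth3_def)
  have IH: "resolved x' y'" if "?D = g * cross_det x' y'" "g > 1" for g x' y'
  proof (rule less.hyps)
    show "smooth3 (cross_det x' y')" using smooth3_factor less.prems that by auto
    then have "cross_det x' y' > 0" by (simp add: smooth3_def)
    then show "nat (cross_det x' y') < nat ?D" using that by simp
  qed
  obtain p q r s where qx: "quotient_of x = (p, q)" and qy: "quotient_of y = (r, s)"
    by (metis surj_pair)
  note cop = quotient_of_coprime[OF qx] quotient_of_coprime[OF qy]
  have D: "?D = q * r - p * s" by (simp add: cross_det_def qx qy)
  obtain g p' q' where g: "g > 0" "p + r = g * p'" "q + s = g * q'"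
    "quotient_of ?w = (p', q')" "coprime p' q'"
    "?D = g * cross_det x ?w" "?D = g * cross_det ?w y"
    using mediant_quotient[OF qx qy] by metis
  show ?case
  proof (cases "g = 1")
    case False
    then have "g > 1" using g(1) by simp
    then show ?thesis using IH g(6,7) resolved_via_mediant by blast
  next
    case g1: True
    show ?thesis
    proof (cases "?D = 1")
      case True
      then show ?thesis by (rule cross_det_1_resolved)
    next
      case False
      \<comment> \<open>Since \<open>g = 1\<close>, the coordinates of the unreduced mediant are
        already coprime.\<close>
      have no_prime: "\<not> (l dvd p + r \<and> l dvd q + s)" if "prime l" for l
        using prime_dvd_multiples_of_coprime[OF that g(5), of g] g(2,3) g1 that by auto
      have "odd ?D" using even_cross_imp_even_sum[OF cop] no_prime[of 2] D by auto
      then have "3 dvd ?D"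
        using prime_factor_int[of ?D] False D0 less.prems unfolding smooth3_def
        by (metis abs_of_pos)
      \<comment> \<open>Opposite vectors modulo 3 would let a factor 3 cancel, so the vectors are
        equal modulo 3.\<close>
      then have 3: "3 dvd p - r" "3 dvd q - s"
        using three_dvd_cross_imp_three_dvd_sum_or_diff[OF cop] no_prime[of 3] D by auto
      have w: "p' = p + r" "q' = q + s" "?D = cross_det x ?w" "?D = cross_det ?w y"
        using g g1 by auto
      obtain h u v where h: "h > 0" "p + p' = h * u" "q + q' = h * v" "coprime u v"
        "?D = h * cross_det x (mediant x ?w)" "?D = h * cross_det (mediant x ?w) ?w"
        using mediant_quotient[OF qx g(4)] w(3) by metis
      \<comment> \<open>Here \<open>p + p' = 2 * p + r\<close>, which is
        \<open>3 * p - (p - r)\<close>; likewise for the denominators.\<close>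
      have "3 dvd p + p'" "3 dvd q + q'" using 3 w by presburger+
      then have "3 dvd h" using prime_dvd_multiples_of_coprime[of 3 u v h] h by simp
      then have "h > 1" using h(1) zdvd_imp_le by fastforce
      then have left: "resolved x ?w" using IH h(5,6) resolved_via_mediant by blast
      obtain k u' v' where k: "k > 0" "p' + r = k * u'" "q' + s = k * v'" "coprime u' v'"
        "?D = k * cross_det ?w (mediant ?w y)" "?D = k * cross_det (mediant ?w y) y"
        using mediant_quotient[OF g(4) qy] w(4) by metis
      have "3 dvd p' + r" "3 dvd q' + s" using 3 w by presburger+
      then have "3 dvd k" using prime_dvd_multiples_of_coprime[of 3 u' v' k] k by simp
      then have "k > 1" using k(1) zdvd_imp_le by fastforce
      then have "resolved ?w y" using IH k(5,6) resolved_via_mediant by blast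
      with left show ?thesis by (rule resolved_via_mediant)
    qed
  qed
qed

theorem theorem3p3:
  fixes a b c d :: int and m n :: nat
  assumes "b > 0" and "d > 0"
    and "coprime a b" and "coprime c d"
    and "0 \<le> Fract a b" and "Fract a b < Fract c d"
    and "b * c - a * d = 2 ^ m * 3 ^ n"
  shows "(\<forall>x::rat. Fract a b \<le> x \<and> x \<le> Fract c d \<longrightarrow>
            (\<exists>i. x \<in> set (mediant_row (Fract a b) (Fract c d) i))) \<and>
         (\<exists>L. \<forall>i\<ge>L. \<forall>k. Suc k < length (mediant_row (Fract a b) (Fract c d) i) \<longrightarrow>
            cross_det (mediant_row (Fract a b) (Fract c d) i ! k)
                      (mediant_row (Fract a b) (Fract c d) i ! Suc k) = 1)"
proof -
  \<comment> \<open>The given representations are already reduced, so \<open>cross_det\<close> is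
    literally \<open>b * c - a * d\<close>.\<close>
  have "quotient_of (Fract a b) = (a, b)" "quotient_of (Fract c d) = (c, d)"
    using assms(1-4) by (simp_all add: quotient_of_Fract normalize_stable)
  then have "cross_det (Fract a b) (Fract c d) = 2 ^ m * 3 ^ n"
    using assms(7) by (simp add: cross_det_def)
  then have "resolved (Fract a b) (Fract c d)"
    using smooth3_2_3 smooth3_resolved by simp
  then show ?thesis unfolding resolved_def successively_conv_nth by blast
qed

end
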